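(* Let $L>0$, $u_{\max}>0$, let $f(u,\rho)$ be a cost function of speed $u\in[0,u_{\max}]$ and density $\rho\ge 0$, let $\rho_0$ be an initial density on $[0,L]$, and let $C\in\mathbb{R}$ be an arbitrary constant. Define $$f^*(p,\rho)=\min_{0\le\alpha\le u_{\max}}\{f(\alpha,\rho)+\alpha p\}\quad(p\in\mathbb{R}),\qquad U(\rho)=\operatorname*{argmin}_{0\le\alpha\le u_{\max}} f(\alpha,\rho)=f^*_p(0,\rho),$$ where $f^*_p$ denotes the partial derivative of $f^*$ with respect to $p$. For $T>0$, let [MFG] denote the system on $[0,L]\times[0,T]$ $$\rho_t+(\rho u)_x=0,\qquad V_t+f^*(V_x,\rho)=0,\qquad u=f^*_p(V_x,\rho),$$ with initial condition $\rho(x,0)=\rho_0(x)$, terminal condition $V(x,T)=V_T(x)$, and periodic boundary conditions $\rho(0,t)=\rho(L,t)$, $V(0,t)=V(L,t)$. Suppose that: (i) $f(u,\rho)$ is continuously differentiable, and strictly convex with respect to $u$; (ii) the terminal cost is $V_T(x)=C$ for all $x\in[0,L]$; (iii) there exists $T_0>0$ such that, whenever $0<T\le T_0$, the system [MFG] with initial density $\rho_0$ and periodic boundary conditions has a unique solution $\rho^{(T)}(x,t)$, $u^{(T)}(x,t)$, $V^{(T)}(x,t)$, and these solutions are uniformly bounded up to second order derivatives on $0\le x\le L$, $0\le t\le T\le T_0$; that is, there is a constant $M>0$ independent of $T\in(0,T_0]$ such that $\rho^{(T)},u^{(T)},V^{(T)}$ and all their partial derivatives in $(x,t)$ of order at most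 two are bounded in absolute value by $M$ on $[0,L]\times[0,T]$. Then $$\lim_{T\to0}u^{(T)}(x,0)=U(\rho_0(x))\qquad\text{for all }x\in[0,L].$$
   Context: Subscripts $t,x$ denote partial derivatives. Here $\rho$ is a traffic density, $u$ a velocity field and $V$ a value function. Since $f(\cdot,\rho)$ is strictly convex on $[0,u_{\max}]$, the minimizer in the definition of $f^*(p,\rho)$ is unique and equals $f^*_p(p,\rho)$, so the third equation of [MFG] reads $u=\operatorname*{argmin}_{0\le\alpha\le u_{\max}}\{f(\alpha,\rho)+\alpha V_x\}$. The equations are understood pointwise on $[0,L]\times[0,T]$, all partial derivatives being assumed to exist there (one-sided at the boundary). $T$ is the length of the planning horizon, and the limit $T\to0$ means $T\to0^+$. *)

theory Defs
  imports "HOL-Analysis.Analysis"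
begin

text \<open>The cost \<open>f u r\<close> (speed \<open>u\<close>, density \<open>r\<close>) is only meaningful on
  \<open>{0..umax} \<times> {0..}\<close>. Derivatives there are taken within the set, hence one-sided on its
  boundary.\<close>

definition cont_differentiable_cost :: "real \<Rightarrow> (real \<Rightarrow> real \<Rightarrow> real) \<Rightarrow> bool" where
  "cont_differentiable_cost umax f \<longleftrightarrow>
     (\<exists>D :: real \<times> real \<Rightarrow> (real \<times> real) \<Rightarrow>\<^sub>L real.
        (\<forall>z \<in> {0..umax} \<times> {0..}.
           ((\<lambda>(u, r). f u r) has_derivative blinfun_apply (D z)) (at z within {0..umax} \<times> {0..}))
        \<and> continuous_on ({0..umax} \<times> {0..}) D)"

definition strict_convex_on :: "real set \<Rightarrow> (real \<Rightarrow> real) \<Rightarrow> bool" where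
  "strict_convex_on S g \<longleftrightarrow> convex S \<and>
     (\<forall>a\<in>S. \<forall>b\<in>S. \<forall>\<theta>. a \<noteq> b \<longrightarrow> 0 < \<theta> \<longrightarrow> \<theta> < 1 \<longrightarrow>
        g ((1 - \<theta>) * a + \<theta> * b) < (1 - \<theta>) * g a + \<theta> * g b)"

text \<open>For \<open>f\<close> continuous in \<open>u\<close> and \<open>umax \<ge> 0\<close> the infimum is a minimum.\<close>

definition fstar :: "real \<Rightarrow> (real \<Rightarrow> real \<Rightarrow> real) \<Rightarrow> real \<Rightarrow> real \<Rightarrow> real" where
  "fstar umax f p r = (INF \<alpha>\<in>{0..umax}. f \<alpha> r + \<alpha> * p)"

definition fstar_p :: "real \<Rightarrow> (real \<Rightarrow> real \<Rightarrow> real) \<Rightarrow> real \<Rightarrow> real \<Rightarrow> real" where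
  "fstar_p umax f p r = deriv (\<lambda>q. fstar umax f q r) p"

definition opt_speed :: "real \<Rightarrow> (real \<Rightarrow> real \<Rightarrow> real) \<Rightarrow> real \<Rightarrow> real" where
  "opt_speed umax f r = arg_min_on (\<lambda>\<alpha>. f \<alpha> r) {0..umax}"

text \<open>Functions on \<open>[0,L] \<times> [0,T]\<close> are curried as \<open>w x t\<close>; values outside the rectangle are
  irrelevant.\<close>

definition has_partial_x ::
    "real \<Rightarrow> (real \<Rightarrow> real \<Rightarrow> real) \<Rightarrow> real \<Rightarrow> real \<Rightarrow> real \<Rightarrow> bool" where
  "has_partial_x L w d x t \<longleftrightarrow> ((\<lambda>y. w y t) has_real_derivative d) (at x within {0..L})"

definition has_partial_t ::
    "real \<Rightarrow> (real \<Rightarrow> real \<Rightarrow> real) \<Rightarrow> real \<Rightarrow> real \<Rightarrow> real \<Rightarrow> bool" where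
  "has_partial_t T w d x t \<longleftrightarrow> ((\<lambda>s. w x s) has_real_derivative d) (at t within {0..T})"

text \<open>The condition \<open>0 \<le> \<rho> x t\<close> says that \<open>\<rho>\<close> takes values in the domain of the cost, without
  which the equations have no meaning.\<close>

definition MFG_solution ::
    "real \<Rightarrow> real \<Rightarrow> (real \<Rightarrow> real \<Rightarrow> real) \<Rightarrow> (real \<Rightarrow> real) \<Rightarrow> (real \<Rightarrow> real) \<Rightarrow> real \<Rightarrow>
     (real \<Rightarrow> real \<Rightarrow> real) \<Rightarrow> (real \<Rightarrow> real \<Rightarrow> real) \<Rightarrow> (real \<Rightarrow> real \<Rightarrow> real) \<Rightarrow> bool" where
  "MFG_solution L umax f \<rho>0 VT T \<rho> u V \<longleftrightarrow>
     (\<forall>x\<in>{0..L}. \<forall>t\<in>{0..T}. 0 \<le> \<rho> x t \<and>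
        (\<exists>\<rho>t qx Vt Vx.
           has_partial_t T \<rho> \<rho>t x t \<and>
           has_partial_x L (\<lambda>y s. \<rho> y s * u y s) qx x t \<and>
           has_partial_t T V Vt x t \<and>
           has_partial_x L V Vx x t \<and>
           \<rho>t + qx = 0 \<and>
           Vt + fstar umax f Vx (\<rho> x t) = 0 \<and>
           u x t = fstar_p umax f Vx (\<rho> x t))) \<and>
     (\<forall>x\<in>{0..L}. \<rho> x 0 = \<rho>0 x \<and> V x T = VT x) \<and>
     (\<forall>t\<in>{0..T}. \<rho> 0 t = \<rho> L t \<and> V 0 t = V L t)"

definition unique_MFG_solution ::
    "real \<Rightarrow> real \<Rightarrow> (real \<Rightarrow> real \<Rightarrow> real) \<Rightarrow> (real \<Rightarrow> real) \<Rightarrow> (real \<Rightarrow> real) \<Rightarrow> real \<Rightarrow>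
     (real \<Rightarrow> real \<Rightarrow> real) \<Rightarrow> (real \<Rightarrow> real \<Rightarrow> real) \<Rightarrow> (real \<Rightarrow> real \<Rightarrow> real) \<Rightarrow> bool" where
  "unique_MFG_solution L umax f \<rho>0 VT T \<rho> u V \<longleftrightarrow>
     MFG_solution L umax f \<rho>0 VT T \<rho> u V \<and>
     (\<forall>\<rho>' u' V'. MFG_solution L umax f \<rho>0 VT T \<rho>' u' V' \<longrightarrow>
        (\<forall>x\<in>{0..L}. \<forall>t\<in>{0..T}. \<rho>' x t = \<rho> x t \<and> u' x t = u x t \<and> V' x t = V x t))"

text \<open>Existence of all partial derivatives of order at most two, both mixed ones included, with
  a common bound; \<open>wxt\<close> is the \<open>t\<close>-derivative of \<open>wx\<close>. For \<open>L, T > 0\<close> the derivatives are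
  unique.\<close>

definition partials2_bounded ::
    "real \<Rightarrow> real \<Rightarrow> real \<Rightarrow> (real \<Rightarrow> real \<Rightarrow> real) \<Rightarrow> bool" where
  "partials2_bounded L T M w \<longleftrightarrow>
     (\<exists>wx wt wxx wxt wtx wtt. \<forall>x\<in>{0..L}. \<forall>t\<in>{0..T}.
        has_partial_x L w (wx x t) x t \<and> has_partial_t T w (wt x t) x t \<and>
        has_partial_x L wx (wxx x t) x t \<and> has_partial_t T wx (wxt x t) x t \<and>
        has_partial_x L wt (wtx x t) x t \<and> has_partial_t T wt (wtt x t) x t \<and>
        \<bar>w x t\<bar> \<le> M \<and> \<bar>wx x t\<bar> \<le> M \<and> \<bar>wt x t\<bar> \<le> M \<and>
        \<bar>wxx x t\<bar> \<le> M \<and> \<bar>wxt x t\<bar> \<le> M \<and> \<bar>wtx x t\<bar> \<le> M \<and> \<bar>wtt x t\<bar> \<le> M)"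

end

theory Submission
  imports Defs
begin

text \<open>Since \<open>V(\<cdot>,T)\<close> is constant, \<open>V\<^sub>x(x,T) = 0\<close>, and the bound on \<open>V\<^sub>x\<^sub>t\<close> gives
  \<open>\<bar>V\<^sub>x(x,0)\<bar> \<le> M T \<longrightarrow> 0\<close>. The claim then follows from \<open>u = f\<^sup>*\<^sub>p(V\<^sub>x, \<rho>)\<close> at \<open>t = 0\<close>, because
  \<open>f\<^sup>*\<^sub>p(p, r)\<close> is the unique minimizer of \<open>f(\<alpha>, r) + \<alpha> p\<close> (envelope theorem), which is continuous
  in \<open>p\<close> by compactness of \<open>[0, u\<^sub>m\<^sub>a\<^sub>x]\<close>.\<close>

text \<open>The linear term contributes equally to both sides of the convexity inequality.\<close>

lemma strict_convex_on_add_linear: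
  assumes "strict_convex_on S g"
  shows "strict_convex_on S (\<lambda>a. g a + a * p)"
proof -
  have "g ((1 - t) * a + t * b) + ((1 - t) * a + t * b) * p
      < (1 - t) * (g a + a * p) + t * (g b + b * p)"
    if "a \<in> S" "b \<in> S" "a \<noteq> b" "0 < t" "t < 1" for a b t
    using assms that unfolding strict_convex_on_def
    by (simp add: algebra_simps)
  then show ?thesis
    using assms unfolding strict_convex_on_def by blast
qed

text \<open>If the two values were equal, strict convexity would put the midpoint value below the
  minimum.\<close>

lemma strict_convex_on_minimizer_strict:
  assumes conv: "strict_convex_on S g" and "a \<in> S" "b \<in> S" "a \<noteq> b"
    and min: "\<And>c. c \<in> S \<Longrightarrow> g a \<le> g c"
  shows "g a < g b"
proof (rule ccontr)
  assume "\<not> g a < g b"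
  then have "g b = g a"
    using min[OF \<open>b \<in> S\<close>] by simp
  have mid: "g ((1 - 1/2) * a + 1/2 * b) < (1 - 1/2) * g a + 1/2 * g b"
    using conv \<open>a \<in> S\<close> \<open>b \<in> S\<close> \<open>a \<noteq> b\<close> unfolding strict_convex_on_def
    by (elim conjE) (drule bspec[of _ _ a], assumption, drule bspec[of _ _ b], assumption,
        drule spec[of _ "1/2"], simp)
  have "(1 - 1/2) *\<^sub>R a + (1/2) *\<^sub>R b \<in> S"
    using conv \<open>a \<in> S\<close> \<open>b \<in> S\<close> unfolding strict_convex_on_def
    by (intro convexD) auto
  then have "g a \<le> g ((1 - 1/2) * a + 1/2 * b)"
    using min by simp
  with mid \<open>g b = g a\<close> show False
    by (simp add: field_simps)
qed

lemma arg_min_on_strict_convex: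
  fixes S :: "real set" and g :: "real \<Rightarrow> real"
  assumes "compact S" "S \<noteq> {}" "continuous_on S g" "strict_convex_on S g"
  shows "arg_min_on g S \<in> S"
    and "b \<in> S \<Longrightarrow> b \<noteq> arg_min_on g S \<Longrightarrow> g (arg_min_on g S) < g b"
proof -
  obtain a where a: "a \<in> S" "\<And>c. c \<in> S \<Longrightarrow> g a \<le> g c"
    using continuous_attains_inf[OF assms(1-3)] by blast
  then have "is_arg_min g (\<lambda>x. x \<in> S) a"
    by (simp add: is_arg_min_linorder)
  \<comment> \<open>\<open>arg_min_on\<close> is a Hilbert choice, so the mere existence of the
    minimizer \<open>a\<close> makes the chosen point a minimizer.\<close>
  then have m: "is_arg_min g (\<lambda>x. x \<in> S) (arg_min_on g S)"
    unfolding arg_min_on_def arg_min_def by (rule someI)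
  then show "arg_min_on g S \<in> S"
    by (simp add: is_arg_min_linorder)
  show "g (arg_min_on g S) < g b" if "b \<in> S" "b \<noteq> arg_min_on g S"
    using m that strict_convex_on_minimizer_strict[OF assms(4), of "arg_min_on g S" b]
    by (auto simp: is_arg_min_linorder)
qed

text \<open>At tilt \<open>p\<close>, the points of \<open>S\<close> at distance at least
  \<open>e\<close> from \<open>a p\<close> have values above the minimum by a positive gap, by
  compactness. For \<open>q\<close> close to \<open>p\<close> the change of tilt is too small to
  close this gap, so \<open>a q\<close> cannot be one of these points.\<close>

lemma tilted_minimizer_isCont:
  fixes S :: "real set" and a g :: "real \<Rightarrow> real"
  assumes "compact S" "continuous_on S g"
    and a: "\<And>p. a p \<in> S"
    and min: "\<And>p b. b \<in> S \<Longrightarrow> b \<noteq> a p \<Longrightarrow> g (a p) + a p * p < g b + b * p"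
  shows "isCont a p"
  unfolding isCont_def
proof (rule tendstoI)
  fix e :: real
  assume "e > 0"
  let ?F = "\<lambda>b. g b + b * p"
  define K where "K = {b \<in> S. e \<le> dist b (a p)}"
  obtain B where B: "\<And>b. b \<in> S \<Longrightarrow> \<bar>b\<bar> \<le> B"
    using compact_imp_bounded[OF \<open>compact S\<close>] unfolding bounded_real by blast
  have "K = S \<inter> {b. e \<le> dist b (a p)}"
    unfolding K_def by blast
  moreover have "closed {b. e \<le> dist b (a p)}"
    by (intro closed_Collect_le continuous_intros)
  ultimately have "compact K"
    using \<open>compact S\<close> by auto
  show "\<forall>\<^sub>F q in at p. dist (a q) (a p) < e"
  proof (cases "K = {}")
    case True
    then show ?thesis
      using a unfolding K_def by (intro always_eventually) (auto simp: not_le)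
  next
    case False
    have "continuous_on K ?F"
      using assms(2) unfolding K_def
      by (intro continuous_intros) (auto elim: continuous_on_subset)
    then obtain m where m: "m \<in> K" "\<And>b. b \<in> K \<Longrightarrow> ?F m \<le> ?F b"
      using continuous_attains_inf[OF \<open>compact K\<close> False] by blast
    then have "?F (a p) < ?F m"
      using \<open>e > 0\<close> unfolding K_def by (intro min) auto
    \<comment> \<open>The factor \<open>2 * B\<close> bounds the distance between any two points of
      \<open>S\<close>, and hence the effect of the tilt \<open>q - p\<close> on a difference of
      values.\<close>
    moreover have "((\<lambda>q. 2 * B * \<bar>q - p\<bar>) \<longlongrightarrow> 2 * B * \<bar>p - p\<bar>) (at p)"
      by (intro tendsto_intros)
    ultimately have "\<forall>\<^sub>F q in at p. 2 * B * \<bar>q - p\<bar> < ?F m - ?F (a p)"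
      by (intro order_tendstoD(2)) auto
    then show ?thesis
    proof eventually_elim
      case (elim q)
      show ?case
      proof (rule ccontr)
        assume "\<not> dist (a q) (a p) < e"
        then have "?F m \<le> ?F (a q)"
          using m(2) a unfolding K_def by simp
        moreover have "g (a q) + a q * q \<le> g (a p) + a p * q"
          using min[OF a[of p], of q] by (cases "a p = a q") auto
        ultimately have "?F m - ?F (a p) \<le> (a p - a q) * (q - p)"
          by (simp add: algebra_simps)
        also have "\<dots> \<le> \<bar>a p - a q\<bar> * \<bar>q - p\<bar>"
          by (metis abs_ge_self abs_mult)
        also have "\<dots> \<le> 2 * B * \<bar>q - p\<bar>"
          using B[OF a[of p]] B[OF a[of q]] by (intro mult_right_mono) auto
        finally show False
          using elim by simp
      qed
    qed
  qed
qed

text \<open>Testing the minimality of \<open>a p\<close> at \<open>q\<close> and of \<open>a q\<close> at \<open>p\<close> puts the difference quotient of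
  the minimal value between \<open>a p\<close> and \<open>a q\<close>.\<close>

lemma tilted_minimum_DERIV:
  fixes S :: "real set" and a g :: "real \<Rightarrow> real"
  assumes cont: "isCont a p"
    and a: "\<And>p. a p \<in> S"
    and min: "\<And>p b. b \<in> S \<Longrightarrow> g (a p) + a p * p \<le> g b + b * p"
  shows "((\<lambda>p. INF b\<in>S. g b + b * p) has_real_derivative a p) (at p)"
proof -
  define F where "F q = g (a q) + a q * q" for q
  have F: "(INF b\<in>S. g b + b * q) = F q" for q
    unfolding F_def using a min by (intro cInf_eq_minimum) auto
  have bound: "\<bar>(F q - F p) / (q - p) - a p\<bar> \<le> \<bar>a q - a p\<bar>" if "q \<noteq> p" for q
  proof -
    have "F q - F p - a p * (q - p) \<le> 0"
      using min[OF a[of p], of q] by (simp add: F_def algebra_simps)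
    moreover have "(a q - a p) * (q - p) \<le> F q - F p - a p * (q - p)"
      using min[OF a[of q], of p] by (simp add: F_def algebra_simps)
    \<comment> \<open>The error lies between \<open>(a q - a p) * (q - p)\<close> and 0. Not
      dividing yet avoids a case split on the sign of \<open>q - p\<close>.\<close>
    ultimately have "\<bar>F q - F p - a p * (q - p)\<bar> \<le> \<bar>(a q - a p) * (q - p)\<bar>"
      by linarith
    then have "\<bar>F q - F p - a p * (q - p)\<bar> / \<bar>q - p\<bar> \<le> \<bar>a q - a p\<bar>"
      using that by (simp add: abs_mult divide_le_eq)
    moreover have "(F q - F p) / (q - p) - a p = (F q - F p - a p * (q - p)) / (q - p)"
      using that by (simp add: field_simps)
    ultimately show ?thesis
      by (simp add: abs_divide)
  qed
  have "((\<lambda>q. (F q - F p) / (q - p) - a p) \<longlongrightarrow> 0) (at p)"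
  proof (rule Lim_null_comparison)
    show "\<forall>\<^sub>F q in at p. norm ((F q - F p) / (q - p) - a p) \<le> \<bar>a q - a p\<bar>"
      using bound by (auto simp: eventually_at_filter)
    show "((\<lambda>q. \<bar>a q - a p\<bar>) \<longlongrightarrow> 0) (at p)"
      using cont unfolding isCont_def by (simp add: tendsto_rabs_zero_iff LIM_zero)
  qed
  then show ?thesis
    unfolding F has_field_derivative_iff by (rule LIM_zero_cancel)
qed

text \<open>The derivative is the minimizer at tilt \<open>p\<close>, which is continuous in
  \<open>p\<close> and equals \<open>opt_speed\<close> at tilt 0. The filter is
  \<open>nhds 0\<close> rather than \<open>at 0\<close> because the limit is later composed with
  values of \<open>p\<close> that may themselves be 0.\<close>

lemma fstar_p_tendsto_opt_speed:
  assumes "umax \<ge> 0" and cont: "continuous_on {0..umax} (\<lambda>\<alpha>. f \<alpha> r)"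
    and conv: "strict_convex_on {0..umax} (\<lambda>\<alpha>. f \<alpha> r)"
  shows "((\<lambda>p. fstar_p umax f p r) \<longlongrightarrow> opt_speed umax f r) (nhds 0)"
proof -
  define a where "a p = arg_min_on (\<lambda>\<alpha>. f \<alpha> r + \<alpha> * p) {0..umax}" for p
  note arg_min = arg_min_on_strict_convex[OF compact_Icc _ _ strict_convex_on_add_linear[OF conv],
      folded a_def]
  have a: "a p \<in> {0..umax}" for p
    using \<open>umax \<ge> 0\<close> by (intro arg_min(1) continuous_intros cont) auto
  have min: "f (a p) r + a p * p < f b r + b * p" if "b \<in> {0..umax}" "b \<noteq> a p" for p b
    using \<open>umax \<ge> 0\<close> that by (intro arg_min(2) continuous_intros cont) auto
  have isCont: "isCont a p" for p
    using compact_Icc cont a min by (rule tilted_minimizer_isCont)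
  have "fstar_p umax f p r = a p" for p
    unfolding fstar_p_def fstar_def
  proof (intro DERIV_imp_deriv tilted_minimum_DERIV isCont a)
    show "f (a q) r + a q * q \<le> f b r + b * q" if "b \<in> {0..umax}" for q b
      using min[OF that, of q] by (cases "b = a q") auto
  qed
  moreover have "opt_speed umax f r = a 0"
    by (simp add: opt_speed_def a_def)
  ultimately show ?thesis
    using isCont[of 0] by (simp add: continuous_within tendsto_at_iff_tendsto_nhds)
qed

lemma cont_differentiable_cost_continuous_on:
  assumes "cont_differentiable_cost umax f" "r \<ge> 0"
  shows "continuous_on {0..umax} (\<lambda>\<alpha>. f \<alpha> r)"
proof -
  have "continuous_on ({0..umax} \<times> {0..}) (\<lambda>(u, r). f u r)"
    using assms(1) unfolding cont_differentiable_cost_def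
    by (meson has_derivative_continuous_on)
  then have "continuous_on {0..umax} (\<lambda>\<alpha>. (\<lambda>(u, r). f u r) (\<alpha>, r))"
    by (rule continuous_on_compose2) (use \<open>r \<ge> 0\<close> in \<open>auto intro: continuous_on_Pair\<close>)
  then show ?thesis
    by simp
qed

text \<open>Every point of the nondegenerate interval is an accumulation point of it, endpoints
  included.\<close>

lemma has_partial_x_unique:
  assumes "has_partial_x L w d x t" "has_partial_x L w e x t" "L > 0" "x \<in> {0..L}"
  shows "d = e"
  using assms vector_derivative_unique_within_closed_interval[of 0 L x "\<lambda>y. w y t" d e]
  by (simp add: has_partial_x_def has_real_derivative_iff_has_vector_derivative)

lemma MFG_solution_initial_speed:
  assumes "L > 0" "T > 0" "x \<in> {0..L}" and VT: "\<forall>x\<in>{0..L}. VT x = C"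
    and sol: "MFG_solution L umax f \<rho>0 VT T \<rho> u V" and bd: "partials2_bounded L T M V"
  obtains p where "u x 0 = fstar_p umax f p (\<rho>0 x)" "\<bar>p\<bar> \<le> M * T"
proof -
  from bd obtain Vx Vxt where
    Vx: "\<And>x t. x \<in> {0..L} \<Longrightarrow> t \<in> {0..T} \<Longrightarrow> has_partial_x L V (Vx x t) x t" and
    Vxt: "\<And>x t. x \<in> {0..L} \<Longrightarrow> t \<in> {0..T} \<Longrightarrow>
      has_partial_t T Vx (Vxt x t) x t \<and> \<bar>Vxt x t\<bar> \<le> M"
    unfolding partials2_bounded_def by metis
  have "V y T = C" if "y \<in> {0..L}" for y
    using sol VT that unfolding MFG_solution_def by simp
  then have "has_partial_x L V 0 x T"
    unfolding has_partial_x_def using \<open>x \<in> {0..L}\<close>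
    \<comment> \<open>\<open>V\<close> is known to be constant only on the interval, which suffices
      because the derivative is taken within it.\<close>
    by (subst has_field_derivative_cong_eventually[where g = "\<lambda>_. C"])
      (auto simp: eventually_at_filter)
  then have "Vx x T = 0"
    using Vx[of x T] assms(1-3) by (auto intro: has_partial_x_unique)
  \<comment> \<open>This is the mean value inequality in time, with the bound on the mixed
    derivative, from the terminal time back to 0.\<close>
  have "norm (Vx x 0 - Vx x T) \<le> M * norm (0 - T)"
    using \<open>T > 0\<close> Vxt[OF \<open>x \<in> {0..L}\<close>]
    by (intro field_differentiable_bound[of "{0..T}" "Vx x" "Vxt x"])
      (auto simp: has_partial_t_def)
  then have "\<bar>Vx x 0\<bar> \<le> M * T"
    using \<open>Vx x T = 0\<close> \<open>T > 0\<close> by simp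
  \<comment> \<open>The system supplies its own x-derivative of \<open>V\<close>. Uniqueness of the
    derivative identifies it with \<open>Vx x 0\<close>, so that the bound applies to the argument
    of \<open>fstar_p\<close>.\<close>
  moreover have "\<exists>p. has_partial_x L V p x 0 \<and> u x 0 = fstar_p umax f p (\<rho>0 x)"
  proof -
    have "\<rho> x 0 = \<rho>0 x" and "\<exists>p. has_partial_x L V p x 0 \<and> u x 0 = fstar_p umax f p (\<rho> x 0)"
      using sol \<open>x \<in> {0..L}\<close> \<open>T > 0\<close> unfolding MFG_solution_def
      by (blast, metis atLeastAtMost_iff less_eq_real_def order_refl)
    then show ?thesis
      by simp
  qed
  moreover have "has_partial_x L V (Vx x 0) x 0"
    using Vx \<open>x \<in> {0..L}\<close> \<open>T > 0\<close> by simp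
  ultimately show thesis
    using has_partial_x_unique \<open>L > 0\<close> \<open>x \<in> {0..L}\<close> that by metis
qed

theorem theorem5p2:
  fixes L umax C T0 M :: real
    and f :: "real \<Rightarrow> real \<Rightarrow> real"
    and \<rho>0 VT :: "real \<Rightarrow> real"
    and \<rho> u V :: "real \<Rightarrow> real \<Rightarrow> real \<Rightarrow> real"
  assumes "L > 0" and "umax > 0"
    and "\<forall>x\<in>{0..L}. 0 \<le> \<rho>0 x"
    and "cont_differentiable_cost umax f"
    and "\<forall>r\<ge>0. strict_convex_on {0..umax} (\<lambda>\<alpha>. f \<alpha> r)"
    and "\<forall>x\<in>{0..L}. VT x = C"
    and "T0 > 0" and "M > 0"
    and "\<forall>T. 0 < T \<and> T \<le> T0 \<longrightarrow> unique_MFG_solution L umax f \<rho>0 VT T (\<rho> T) (u T) (V T)"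
    and "\<forall>T. 0 < T \<and> T \<le> T0 \<longrightarrow>
           partials2_bounded L T M (\<rho> T) \<and> partials2_bounded L T M (u T) \<and>
           partials2_bounded L T M (V T)"
  shows "\<forall>x\<in>{0..L}. ((\<lambda>T. u T x 0) \<longlongrightarrow> opt_speed umax f (\<rho>0 x)) (at_right 0)"
proof
  fix x
  assume x: "x \<in> {0..L}"
  have "\<exists>p. u T x 0 = fstar_p umax f p (\<rho>0 x) \<and> \<bar>p\<bar> \<le> M * T" if "0 < T" "T \<le> T0" for T
    using MFG_solution_initial_speed[OF \<open>L > 0\<close> that(1) x assms(6)] assms(9,10) that
    unfolding unique_MFG_solution_def by metis
  \<comment> \<open>Choosing one slope for each horizon turns the slopes into a function of
    \<open>T\<close>, whose limit at 0 can be taken.\<close>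
  then obtain p where
    p: "\<And>T. 0 < T \<Longrightarrow> T \<le> T0 \<Longrightarrow> u T x 0 = fstar_p umax f (p T) (\<rho>0 x) \<and> \<bar>p T\<bar> \<le> M * T"
    by metis
  have ev: "\<forall>\<^sub>F T in at_right 0. 0 < T \<and> T \<le> T0"
    using eventually_at_right_real[OF \<open>T0 > 0\<close>] by eventually_elim auto
  have "(p \<longlongrightarrow> 0) (at_right 0)"
  proof (rule Lim_null_comparison)
    show "\<forall>\<^sub>F T in at_right 0. norm (p T) \<le> M * T"
      using ev by eventually_elim (use p in auto)
    show "((\<lambda>T. M * T) \<longlongrightarrow> 0) (at_right 0)"
      by (auto intro!: tendsto_eq_intros)
  qed
  moreover have "((\<lambda>q. fstar_p umax f q (\<rho>0 x)) \<longlongrightarrow> opt_speed umax f (\<rho>0 x)) (nhds 0)"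
    using assms(2-5) x
    by (intro fstar_p_tendsto_opt_speed cont_differentiable_cost_continuous_on) auto
  ultimately have "((\<lambda>T. fstar_p umax f (p T) (\<rho>0 x)) \<longlongrightarrow> opt_speed umax f (\<rho>0 x)) (at_right 0)"
    by (rule filterlim_compose[rotated])
  moreover have "\<forall>\<^sub>F T in at_right 0. fstar_p umax f (p T) (\<rho>0 x) = u T x 0"
    using ev by eventually_elim (use p in auto)
  ultimately show "((\<lambda>T. u T x 0) \<longlongrightarrow> opt_speed umax f (\<rho>0 x)) (at_right 0)"
    by (rule Lim_transform_eventually)
qed

end
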